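(* Let $K$ be a field of characteristic not two. Then the variety $\mathcal{SJ}_K$ generated by the special Jordan $K$-algebras is MLM. That is: for every field extension $K\subseteq F$, every $F$-algebra $A\in\mathcal{SJ}_F$ and every finite subset $Y=\{y_1,\dots,y_n\}\subseteq A$ of at least two elements such that the $K$-subalgebra of $A$ generated by $Y$ is the free $K$-algebra in $\mathcal{SJ}_K$ with set of free generators $Y$, the $F$-subalgebra of $A$ generated by $Y$ is the free $F$-algebra in $\mathcal{SJ}_F$ with set of free generators $Y$.
   Context: For a field $K$ of characteristic not two and an associative $K$-algebra $B$, $B^{(+)}$ denotes the vector space $B$ with the product $x\circ y=\frac12(xy+yx)$. A special Jordan $K$-algebra is a subspace of some associative $K$-algebra $B$ that is closed under $\circ$, with product $\circ$. The variety $\mathcal{SJ}_K$ is the variety of $K$-algebras generated by all special Jordan $K$-algebras; it consists of all $K$-algebras that are homomorphic images of special Jordan $K$-algebras. The free $K$-algebra in $\mathcal{SJ}_K$ on a set $Y$ is the free special Jordan algebra $\mathcal{SJ}_K(Y)$, i.e. the subalgebra of $K\langle Y\rangle^{(+)}$ generated by $Y$, where $K\langle Y\rangle$ is the free associative $K$-algebra on $Y$. "The subalgebra of $A$ generated by $Y$ is the free algebra with set of free generators $Y$" means that the canonical homomorphism from the free algebra on $Y$ to $A$ extending the inclusion $Y\subseteq A$ is injective. *)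

theory Defs
  imports Complex_Main "HOL-Library.Poly_Mapping"
begin

section \<open>Algebras that need be neither associative nor unital\<close>

text \<open>
  The carrier of an algebra is a whole type. An associative (possibly non-unital) algebra is a type
  \<^typ>\<open>'b::ring\<close> with a scalar multiplication \<open>s\<close> such that \<open>nonassoc_algebra s (*)\<close>.
\<close>

locale nonassoc_algebra = vector_space scale
  for scale :: "'f::field \<Rightarrow> 'a::ab_group_add \<Rightarrow> 'a" +
  fixes mult :: "'a \<Rightarrow> 'a \<Rightarrow> 'a"
  assumes mult_add_left: "mult (x + y) z = mult x z + mult y z"
    and mult_add_right: "mult x (y + z) = mult x y + mult x z"
    and mult_scale_left: "mult (scale c x) y = scale c (mult x y)"
    and mult_scale_right: "mult x (scale c y) = scale c (mult x y)"

definition subalgebra ::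
    "('f::field \<Rightarrow> 'a::ab_group_add \<Rightarrow> 'a) \<Rightarrow> ('a \<Rightarrow> 'a \<Rightarrow> 'a) \<Rightarrow> 'a set \<Rightarrow> bool" where
  "subalgebra scale mult S \<longleftrightarrow>
     module.subspace scale S \<and> (\<forall>x\<in>S. \<forall>y\<in>S. mult x y \<in> S)"

definition algebra_hom_on ::
    "'b set \<Rightarrow> ('f::field \<Rightarrow> 'b::ab_group_add \<Rightarrow> 'b) \<Rightarrow> ('b \<Rightarrow> 'b \<Rightarrow> 'b) \<Rightarrow>
     ('f \<Rightarrow> 'a::ab_group_add \<Rightarrow> 'a) \<Rightarrow> ('a \<Rightarrow> 'a \<Rightarrow> 'a) \<Rightarrow> ('b \<Rightarrow> 'a) \<Rightarrow> bool" where
  "algebra_hom_on S scale1 mult1 scale2 mult2 h \<longleftrightarrow>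
     (\<forall>x\<in>S. \<forall>y\<in>S. h (x + y) = h x + h y) \<and>
     (\<forall>c. \<forall>x\<in>S. h (scale1 c x) = scale2 c (h x)) \<and>
     (\<forall>x\<in>S. \<forall>y\<in>S. h (mult1 x y) = mult2 (h x) (h y))"

section \<open>Special Jordan algebras and their variety\<close>

definition jordan_prod :: "('f::field \<Rightarrow> 'b::ring \<Rightarrow> 'b) \<Rightarrow> 'b \<Rightarrow> 'b \<Rightarrow> 'b" where
  "jordan_prod scale x y = scale (1 / 2) (x * y + y * x)"

definition special_jordan :: "('f::field \<Rightarrow> 'b::ring \<Rightarrow> 'b) \<Rightarrow> 'b set \<Rightarrow> bool" where
  "special_jordan scale J \<longleftrightarrow>
     nonassoc_algebra scale (*) \<and> subalgebra scale (jordan_prod scale) J"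

text \<open>
  The variety generated by the special Jordan algebras consists of the homomorphic images of special
  Jordan algebras. HOL cannot quantify over the type of the ambient associative algebra inside a
  formula, so this type is an argument. In a theorem with the hypothesis
  \<open>in_SJ TYPE('b) scale mult\<close> and \<open>'b\<close> occurring nowhere else, \<open>'b\<close> is universally
  quantified outside the implication, so the hypothesis allows an arbitrary associative algebra.
\<close>

definition in_SJ ::
    "'b::ring itself \<Rightarrow> ('f::field \<Rightarrow> 'a::ab_group_add \<Rightarrow> 'a) \<Rightarrow> ('a \<Rightarrow> 'a \<Rightarrow> 'a) \<Rightarrow> bool" where
  "in_SJ (_ :: 'b itself) scale mult \<longleftrightarrow>
     nonassoc_algebra scale mult \<and>
     (\<exists>(scaleB :: 'f \<Rightarrow> 'b \<Rightarrow> 'b) J h.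
        special_jordan scaleB J \<and>
        algebra_hom_on J scaleB (jordan_prod scaleB) scale mult h \<and>
        h ` J = UNIV)"

section \<open>The free special Jordan algebra\<close>

text \<open>
  Lists form the free monoid (written additively, as required by the convolution product on
  \<^typ>\<open>'m \<Rightarrow>\<^sub>0 'k\<close>), so \<^typ>\<open>'x list \<Rightarrow>\<^sub>0 'k\<close> is the free associative algebra on the type \<^typ>\<open>'x\<close>.
\<close>

instantiation list :: (type) monoid_add
begin

definition zero_list :: "'a list" where "zero_list = []"

definition plus_list :: "'a list \<Rightarrow> 'a list \<Rightarrow> 'a list" where "plus_list = append"

instance
  by standard (simp_all add: zero_list_def plus_list_def)

end

definition free_scale :: "'k::field \<Rightarrow> ('x list \<Rightarrow>\<^sub>0 'k) \<Rightarrow> ('x list \<Rightarrow>\<^sub>0 'k)" where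
  "free_scale c = Poly_Mapping.map ((*) c)"

definition free_var :: "'x \<Rightarrow> ('x list \<Rightarrow>\<^sub>0 'k::field)" where
  "free_var y = Poly_Mapping.single [y] 1"

text \<open>
  The elements of \<open>free_SJ Y\<close> involve only words in letters from \<open>Y\<close>, so it does not
  matter that the ambient associative algebra is free on the whole type \<^typ>\<open>'x\<close>.
\<close>

definition free_SJ :: "'x set \<Rightarrow> ('x list \<Rightarrow>\<^sub>0 'k::field) set" where
  "free_SJ Y = subalgebra free_scale (jordan_prod free_scale) hull (free_var ` Y)"

lemma lookup_free_scale: "Poly_Mapping.lookup (free_scale c p) w = c * Poly_Mapping.lookup p w"
  unfolding free_scale_def by transfer (simp add: when_def)

lemma free_scale_conv_mult: "free_scale c p = Poly_Mapping.single 0 c * p"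
  unfolding free_scale_def by (rule mult_map_scale_conv_mult)

lemma single_0_commute:
  "p * Poly_Mapping.single 0 c = Poly_Mapping.single 0 c * (p :: 'x list \<Rightarrow>\<^sub>0 'k::field)"
proof (induction p rule: update_induct)
  case (update p w b)
  have "Poly_Mapping.update w b p = p + Poly_Mapping.single w b"
    using update.hyps
    by (intro poly_mapping_eqI) (auto simp: lookup_update lookup_add lookup_single in_keys_iff)
  then show ?case
    using update.IH by (simp add: distrib_left distrib_right mult_single mult.commute)
qed simp

lemma free_nonassoc_algebra:
  "nonassoc_algebra (free_scale :: 'k::field \<Rightarrow> ('x list \<Rightarrow>\<^sub>0 'k) \<Rightarrow> _) (*)"
proof
  fix c d :: 'k and p q r :: "'x list \<Rightarrow>\<^sub>0 'k"
  show "free_scale c (p + q) = free_scale c p + free_scale c q"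
    by (intro poly_mapping_eqI) (simp add: lookup_free_scale lookup_add distrib_left)
  show "free_scale (c + d) p = free_scale c p + free_scale d p"
    by (intro poly_mapping_eqI) (simp add: lookup_free_scale lookup_add distrib_right)
  show "free_scale c (free_scale d p) = free_scale (c * d) p"
    by (intro poly_mapping_eqI) (simp add: lookup_free_scale mult.assoc)
  show "free_scale 1 p = p"
    by (intro poly_mapping_eqI) (simp add: lookup_free_scale)
  show "(p + q) * r = p * r + q * r"
    by (rule distrib_right)
  show "p * (q + r) = p * q + p * r"
    by (rule distrib_left)
  show "free_scale c p * q = free_scale c (p * q)"
    unfolding free_scale_conv_mult by (rule mult.assoc)
  show "p * free_scale c q = free_scale c (p * q)"
    unfolding free_scale_conv_mult mult.assoc[symmetric]
    by (rule arg_cong[where f = "\<lambda>u. u * q", OF single_0_commute])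
qed

text \<open>
  The subalgebra generated by \<open>Y\<close> is free on \<open>Y\<close>: the canonical homomorphism from the free special
  Jordan algebra (which is determined by its values on the generators) is injective.
\<close>

definition generates_free_SJ ::
    "('k::field \<Rightarrow> 'a::ab_group_add \<Rightarrow> 'a) \<Rightarrow> ('a \<Rightarrow> 'a \<Rightarrow> 'a) \<Rightarrow> 'a set \<Rightarrow> bool" where
  "generates_free_SJ scale mult Y \<longleftrightarrow>
     (\<exists>h :: ('a list \<Rightarrow>\<^sub>0 'k) \<Rightarrow> 'a.
        algebra_hom_on (free_SJ Y) free_scale (jordan_prod free_scale) scale mult h \<and>
        (\<forall>y\<in>Y. h (free_var y) = y) \<and>
        inj_on h (free_SJ Y))"

lemma canonical_hom_unique:
  fixes h1 h2 :: "('x list \<Rightarrow>\<^sub>0 'k::field) \<Rightarrow> 'a::ab_group_add"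
  assumes h1: "algebra_hom_on (free_SJ Y) free_scale (jordan_prod free_scale) scale mult h1"
    and h2: "algebra_hom_on (free_SJ Y) free_scale (jordan_prod free_scale) scale mult h2"
    and gen: "\<And>y. y \<in> Y \<Longrightarrow> h1 (free_var y) = h2 (free_var y)"
    and p: "p \<in> free_SJ Y"
  shows "h1 p = h2 p"
proof -
  interpret free: nonassoc_algebra "free_scale :: 'k \<Rightarrow> ('x list \<Rightarrow>\<^sub>0 'k) \<Rightarrow> _" "(*)"
    by (rule free_nonassoc_algebra)
  let ?sub = "subalgebra (free_scale :: 'k \<Rightarrow> ('x list \<Rightarrow>\<^sub>0 'k) \<Rightarrow> _) (jordan_prod free_scale)"
  define E where "E = {q \<in> free_SJ Y. h1 q = h2 q}"
  have SJ: "?sub (free_SJ Y)"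
    unfolding free_SJ_def
    by (rule hull_in) (auto simp: subalgebra_def intro!: free.subspace_Inter)
  have zero: "h 0 = 0"
    if "algebra_hom_on (free_SJ Y) free_scale (jordan_prod free_scale) scale mult h"
    for h :: "('x list \<Rightarrow>\<^sub>0 'k) \<Rightarrow> 'a"
  proof -
    have "0 \<in> (free_SJ Y :: ('x list \<Rightarrow>\<^sub>0 'k) set)"
      using SJ by (auto simp: subalgebra_def free.subspace_def)
    then have "h (0 + 0) = h 0 + h 0"
      using that unfolding algebra_hom_on_def by blast
    then show ?thesis by simp
  qed
  have "?sub E"
    unfolding subalgebra_def free.subspace_def
  proof (intro conjI allI ballI)
    show "0 \<in> E"
      using SJ zero[OF h1] zero[OF h2] by (simp add: E_def subalgebra_def free.subspace_def)
  next
    fix q r assume "q \<in> E" "r \<in> E"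
    then show "q + r \<in> E"
      using SJ h1 h2 unfolding E_def subalgebra_def free.subspace_def algebra_hom_on_def by simp
  next
    fix c q assume "q \<in> E"
    then show "free_scale c q \<in> E"
      using SJ h1 h2 unfolding E_def subalgebra_def free.subspace_def algebra_hom_on_def by simp
  next
    fix q r assume "q \<in> E" "r \<in> E"
    then show "jordan_prod free_scale q r \<in> E"
      using SJ h1 h2 unfolding E_def subalgebra_def free.subspace_def algebra_hom_on_def by simp
  qed
  moreover have "free_var ` Y \<subseteq> E"
    using gen hull_subset[of "free_var ` Y" ?sub] by (auto simp: E_def free_SJ_def)
  ultimately have "free_SJ Y \<subseteq> E"
    unfolding free_SJ_def by (intro hull_minimal)
  then show ?thesis using p by (auto simp: E_def)
qed

section \<open>Field extensions\<close>

locale field_extension =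
  fixes \<iota> :: "'k::field \<Rightarrow> 'f::field"
  assumes emb_one: "\<iota> 1 = 1"
    and emb_add: "\<iota> (x + y) = \<iota> x + \<iota> y"
    and emb_mult: "\<iota> (x * y) = \<iota> x * \<iota> y"

end

theory Submission
  imports Defs
begin

text \<open>
  Since \<open>A\<close> lies in the variety over \<open>F\<close>, there is a canonical homomorphism \<open>h\<close> from the free special
  Jordan \<open>F\<close>-algebra on \<open>Y\<close> to \<open>A\<close> (\<open>canonical_hom_exists\<close>). Let \<open>I\<close> be its kernel and let \<open>S\<close> be the
  image of the free special Jordan \<open>K\<close>-algebra under extension of scalars. On \<open>S\<close> the homomorphism \<open>h\<close>
  is the canonical one over \<open>K\<close>, which is injective by assumption, so \<open>S\<close> meets \<open>I\<close> only in \<open>0\<close>.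
  Moreover \<open>S\<close> spans the free algebra over \<open>F\<close> (\<open>free_SJ_subset_span\<close>). It remains to see that an
  ideal \<open>I\<close> with \<open>S \<inter> I = 0\<close> vanishes.

  Let \<open>f = a\<^sub>1 p\<^sub>1 + \<dots> + a\<^sub>m p\<^sub>m\<close> be in \<open>I\<close> with \<open>a\<^sub>i\<close> in \<open>F\<close> and \<open>p\<^sub>i\<close> in \<open>S\<close>, where \<open>p\<^sub>1 \<noteq> 0\<close>. For a
  generator \<open>z\<close> the element \<open>p\<^sub>1 \<circ> (z f z) - f \<circ> (z p\<^sub>1 z)\<close> is again in \<open>I\<close>, because \<open>z f z\<close> is a Jordan
  expression in \<open>z\<close> and \<open>f\<close>. It depends linearly on \<open>f\<close>, vanishes at \<open>f = p\<^sub>1\<close>, and maps \<open>S\<close> to \<open>S\<close>. It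
  is therefore a combination of \<open>m - 1\<close> elements of \<open>S\<close>, and it is \<open>0\<close> by induction on \<open>m\<close>
  (\<open>ideal_element_eq_0\<close>). Up to the factor \<open>1 / 2\<close> it is the commutator of \<open>p\<^sub>1 z f - f z p\<^sub>1\<close> with \<open>z\<close>.
  If these commutators vanish for two different generators \<open>z\<close>, a comparison of top-degree
  coefficients forces \<open>f = c p\<^sub>1\<close> (\<open>proportional_if_brackets_commute\<close>); this is where two
  elements of \<open>Y\<close> are used. If \<open>c \<noteq> 0\<close>, then \<open>p\<^sub>1\<close> is a nonzero element of \<open>S \<inter> I\<close>. So \<open>f = 0\<close>.
\<close>

section \<open>Top-degree coefficients in the free associative algebra\<close>

interpretation free: nonassoc_algebra "free_scale :: 'k::field \<Rightarrow> ('x list \<Rightarrow>\<^sub>0 'k) \<Rightarrow> _" "(*)"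
  by (rule free_nonassoc_algebra)

abbreviation coeff :: "('x list \<Rightarrow>\<^sub>0 'k::zero) \<Rightarrow> 'x list \<Rightarrow> 'k" where
  "coeff \<equiv> Poly_Mapping.lookup"

abbreviation support :: "('x list \<Rightarrow>\<^sub>0 'k::zero) \<Rightarrow> 'x list set" where
  "support \<equiv> Poly_Mapping.keys"

abbreviation degree_le :: "('x list \<Rightarrow>\<^sub>0 'k::zero) \<Rightarrow> nat \<Rightarrow> bool" where
  "degree_le p n \<equiv> \<forall>w \<in> support p. length w \<le> n"

text \<open>
  A word of the maximal length \<open>length u + length v\<close> has only one factorization into words that are
  not longer than \<open>u\<close> and \<open>v\<close>. So top-degree coefficients multiply without summation, and no ordering
  of the words is needed to find nonzero coefficients of products.
\<close>

lemma coeff_mult_top: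
  fixes p q :: "'x list \<Rightarrow>\<^sub>0 'k::field"
  assumes p: "degree_le p (length u)" and q: "degree_le q (length v)"
  shows "coeff (p * q) (u @ v) = coeff p u * coeff q v"
proof -
  have inner: "coeff p l * Sum_any (\<lambda>r. coeff q r when u @ v = l + r)
      = (coeff p u * coeff q v when l = u)" for l
  proof (cases "l = u")
    case True
    then show ?thesis by (simp add: plus_list_def eq_commute[of v])
  next
    case False
    have "coeff q r = 0" if "coeff p l \<noteq> 0" "u @ v = l @ r" for r
    proof (rule ccontr)
      assume "coeff q r \<noteq> 0"
      then have "length l \<le> length u" "length r \<le> length v"
        using p q \<open>coeff p l \<noteq> 0\<close> by (auto simp: in_keys_iff)
      moreover have "length u + length v = length l + length r"
        using \<open>u @ v = l @ r\<close> by (metis length_append)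
      ultimately have "length l = length u" by simp
      then show False using \<open>u @ v = l @ r\<close> \<open>l \<noteq> u\<close> by simp
    qed
    then have "coeff p l = 0 \<or> (\<forall>r. u @ v = l @ r \<longrightarrow> coeff q r = 0)" by blast
    moreover have "Sum_any (\<lambda>r. coeff q r when u @ v = l @ r) = 0"
      if "\<forall>r. u @ v = l @ r \<longrightarrow> coeff q r = 0"
    proof -
      have "(\<lambda>r. coeff q r when u @ v = l @ r) = (\<lambda>r. 0)"
        using that by (auto simp: when_def)
      then show ?thesis by (simp only: Sum_any.neutral)
    qed
    ultimately show ?thesis using False by (auto simp: plus_list_def)
  qed
  show ?thesis by (simp add: lookup_mult inner)
qed

lemma degree_le_mult:
  fixes p q :: "'x list \<Rightarrow>\<^sub>0 'k::field"
  assumes "degree_le p m" "degree_le q n"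
  shows "degree_le (p * q) (m + n)"
  using assms keys_mult[of p q] by (fastforce simp: plus_list_def)

lemma degree_le_diff:
  fixes p q :: "'x list \<Rightarrow>\<^sub>0 'k::field"
  assumes "degree_le p n" "degree_le q n"
  shows "degree_le (p - q) n"
  using assms keys_diff[of p q] by blast

lemma degree_le_free_var: "degree_le (free_var y :: 'x list \<Rightarrow>\<^sub>0 'k::field) (length [x])"
  by (simp add: free_var_def)

lemma coeff_free_var: "coeff (free_var y :: 'x list \<Rightarrow>\<^sub>0 'k::field) [x] = (if x = y then 1 else 0)"
  by (simp add: free_var_def lookup_single when_def)

lemma obtain_top_word:
  fixes p :: "'x list \<Rightarrow>\<^sub>0 'k::field"
  assumes "p \<noteq> 0"
  obtains u where "coeff p u \<noteq> 0" "degree_le p (length u)"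
proof -
  have fin: "finite (length ` support p)" "length ` support p \<noteq> {}"
    using assms by auto
  then obtain u where "u \<in> support p" "length u = Max (length ` support p)"
    using Max_in[OF fin] by (metis imageE)
  then show thesis
    using that[of u] Max_ge[OF fin(1)] by (auto simp: in_keys_iff)
qed

text \<open>
  Comparing the coefficients of \<open>h z\<close> and \<open>z h\<close> at \<open>x # v @ [z]\<close> shows that a top-degree word \<open>x # v\<close> of
  \<open>h\<close> begins with \<open>z\<close> and that its rotation \<open>v @ [z]\<close> occurs in \<open>h\<close> too. Rotating all the way round
  puts every letter in first position.
\<close>

lemma top_words_of_commutant_of_letter:
  fixes h :: "'x list \<Rightarrow>\<^sub>0 'k::field"
  assumes comm: "h * free_var z = free_var z * h"
    and deg: "degree_le h (length w)"
    and w: "coeff h w \<noteq> 0"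
  shows "set w \<subseteq> {z}"
proof -
  have step: "x = z \<and> coeff h (v @ [z]) \<noteq> 0"
    if len: "length (x # v) = length w" and nz: "coeff h (x # v) \<noteq> 0" for x v
  proof -
    have "coeff h (x # v) = coeff (h * free_var z) ((x # v) @ [z])"
      by (subst coeff_mult_top) (use deg len degree_le_free_var in \<open>simp_all add: coeff_free_var\<close>)
    also have "\<dots> = coeff (free_var z * h) ([x] @ (v @ [z]))"
      by (simp add: comm)
    also have "\<dots> = (if x = z then 1 else 0) * coeff h (v @ [z])"
      by (subst coeff_mult_top) (use deg len degree_le_free_var in \<open>simp_all add: coeff_free_var\<close>)
    finally show ?thesis using nz by (auto split: if_splits)
  qed
  have rotate: "coeff h (rotate k w) \<noteq> 0" for k
  proof (induction k)
    case (Suc k)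
    show ?case
    proof (cases "rotate k w")
      case (Cons x v)
      then show ?thesis
        using step[of x v] Suc by (metis length_rotate rotate1.simps(2) rotate_Suc)
    qed (use Suc in auto)
  qed (use w in simp)
  show ?thesis
  proof
    fix x assume "x \<in> set w"
    then obtain k where k: "k < length w" "x = w ! k" by (metis in_set_conv_nth)
    then have "hd (rotate k w) = x" by (subst hd_rotate_conv_nth) auto
    moreover have "rotate k w \<noteq> []" using k by auto
    ultimately have "x = z"
      using step[of x "tl (rotate k w)"] rotate[of k] by (metis length_rotate list.collapse)
    then show "x \<in> {z}" by simp
  qed
qed

text \<open>
  The expression \<open>p z f - f z p\<close> is bilinear and alternating in \<open>p\<close> and \<open>f\<close>, so \<open>f\<close> may be changed by a
  multiple of \<open>p\<close> to remove the coefficient at a top word \<open>u\<close> of \<open>p\<close>. If the remainder \<open>q\<close> is not \<open>0\<close>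
  and has a top word \<open>v\<close>, then one of \<open>u z v\<close> and \<open>v z u\<close> is a top-degree word of \<open>p z q - q z p\<close> for a
  suitable \<open>z\<close> and contains a letter other than \<open>z\<close>. This is impossible for an element that commutes
  with \<open>z\<close>.
\<close>

lemma proportional_if_brackets_commute:
  fixes p f :: "'x list \<Rightarrow>\<^sub>0 'k::field"
  assumes "p \<noteq> 0" and "y1 \<noteq> y2"
    and comm: "\<And>z. z \<in> {y1, y2} \<Longrightarrow>
      (p * free_var z * f - f * free_var z * p) * free_var z
        = free_var z * (p * free_var z * f - f * free_var z * p)"
  shows "\<exists>c. f = free_scale c p"
proof -
  obtain u where u: "coeff p u \<noteq> 0" "degree_le p (length u)"
    using obtain_top_word[OF \<open>p \<noteq> 0\<close>] by blast
  define c where "c = coeff f u / coeff p u"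
  define q where "q = f - free_scale c p"
  have qu: "coeff q u = 0"
    using u(1) by (simp add: q_def c_def lookup_minus lookup_free_scale)
  have "q = 0"
  proof (rule ccontr)
    assume "q \<noteq> 0"
    then obtain v where v: "coeff q v \<noteq> 0" "degree_le q (length v)"
      using obtain_top_word by blast
    define b where "b z = p * free_var z * q - q * free_var z * p" for z
    have b: "b z = p * free_var z * f - f * free_var z * p" for z
      by (simp add: b_def q_def algebra_simps free.mult_scale_left free.mult_scale_right)
    have deg: "degree_le (b z) (length u + 1 + length v)" for z
      unfolding b_def
      using degree_le_mult[OF degree_le_mult[OF u(2) degree_le_free_var[of z]] v(2)]
        degree_le_mult[OF degree_le_mult[OF v(2) degree_le_free_var[of z]] u(2)]
      by (intro degree_le_diff) (simp_all add: add_ac)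
    have top: "set w \<subseteq> {z}"
      if "z \<in> {y1, y2}" "length w = length u + 1 + length v" "coeff (b z) w \<noteq> 0" for z w
      using top_words_of_commutant_of_letter[of "b z" z w] comm[OF that(1)] deg[of z] that
      by (simp add: b)
    have mult3: "coeff (r * free_var z * s) (r' @ [x] @ s')
        = coeff r r' * (if x = z then 1 else 0) * coeff s s'"
      if "degree_le r (length r')" "degree_le s (length s')" for r s :: "'x list \<Rightarrow>\<^sub>0 'k" and r' s' x z
    proof -
      have "degree_le (r * free_var z) (length (r' @ [x]))"
        using degree_le_mult[OF that(1) degree_le_free_var[of z]] by simp
      then have "coeff (r * free_var z * s) ((r' @ [x]) @ s')
          = coeff (r * free_var z) (r' @ [x]) * coeff s s'"
        by (rule coeff_mult_top) (fact that(2))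
      also have "coeff (r * free_var z) (r' @ [x]) = coeff r r' * coeff (free_var z) [x]"
        by (rule coeff_mult_top[OF that(1) degree_le_free_var])
      finally show ?thesis by (simp add: coeff_free_var)
    qed
    \<comment> \<open>If the degrees differ, \<open>z\<close> is chosen to disagree with the longer top word at the place where
      the two products would have to match.\<close>
    have unequal: False
      if r: "coeff r r' \<noteq> 0" "degree_le r (length r')" and s: "coeff s s' \<noteq> 0" "degree_le s (length s')"
        and less: "length r' < length s'" and pq: "r = p \<and> r' = u \<and> s = q \<and> s' = v
          \<or> r = q \<and> r' = v \<and> s = p \<and> s' = u" for r s r' s'
    proof -
      obtain z where z: "z \<in> {y1, y2}" "z \<noteq> s' ! length r'"
        using \<open>y1 \<noteq> y2\<close> by auto
      define w where "w = s' @ [z] @ r'"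
      have w: "w = take (length r') s' @ [s' ! length r'] @ (drop (Suc (length r')) s' @ [z] @ r')"
        using id_take_nth_drop[OF less] by (simp add: w_def)
      have "coeff (r * free_var z * s) w = 0"
        unfolding w using r s z less by (subst mult3) auto
      moreover have "coeff (s * free_var z * r) w \<noteq> 0"
        unfolding w_def using r s by (subst mult3) auto
      ultimately have "set w \<subseteq> {z}"
        using z pq by (intro top) (auto simp: b_def w_def lookup_minus)
      then show False using z(2) nth_mem[OF less] by (auto simp: w_def)
    qed
    have "length u = length v"
      using unequal[of p u q v] unequal[of q v p u] u v by (meson nat_neq_iff)
    have "coeff (q * free_var y1 * p) (u @ [y1] @ v) = 0"
      using u v \<open>length u = length v\<close> qu by (subst mult3) auto
    moreover have "coeff (p * free_var y1 * q) (u @ [y1] @ v) \<noteq> 0"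
      using u v by (subst mult3) auto
    ultimately have "set (u @ [y1] @ v) \<subseteq> {y1}"
      by (intro top) (auto simp: b_def lookup_minus)
    then have "u = replicate (length u) y1" "v = replicate (length v) y1"
      by (auto intro!: replicate_eqI)
    then have "u = v" using \<open>length u = length v\<close> by metis
    then show False using v qu by simp
  qed
  then show ?thesis by (auto simp: q_def)
qed

section \<open>A Jordan operator that kills a given element\<close>

lemma nonassoc_algebra_jordan_prod:
  assumes "nonassoc_algebra s ((*) :: 'b::ring \<Rightarrow> _)"
  shows "nonassoc_algebra s (jordan_prod s)"
proof -
  interpret nonassoc_algebra s "(*) :: 'b \<Rightarrow> _" by fact
  show ?thesis
    by unfold_locales
      (simp_all add: jordan_prod_def algebra_simps mult_scale_left mult_scale_right mult.commute)
qed

interpretation free_jordan: nonassoc_algebra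
    "free_scale :: 'k::field \<Rightarrow> ('x list \<Rightarrow>\<^sub>0 'k) \<Rightarrow> _" "jordan_prod free_scale"
  by (rule nonassoc_algebra_jordan_prod) (rule free_nonassoc_algebra)

text \<open>
  The \<open>U\<close>-operator of Jordan theory, which is \<open>f \<mapsto> z f z\<close> in a special Jordan algebra. Writing it with
  Jordan products makes it visible that ideals and subalgebras are preserved.
\<close>

definition jordan_U :: "('x list \<Rightarrow>\<^sub>0 'k::field) \<Rightarrow> ('x list \<Rightarrow>\<^sub>0 'k) \<Rightarrow> ('x list \<Rightarrow>\<^sub>0 'k)" where
  "jordan_U z f = (let J = jordan_prod free_scale in J z (J z f) + J z (J z f) - J (J z z) f)"

text \<open>
  The simpler expression \<open>p \<circ> (f \<circ> z) - f \<circ> (p \<circ> z)\<close> is a multiple of the commutator of \<open>p f - f p\<close> with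
  \<open>z\<close>, so it vanishes for all \<open>z\<close> whenever \<open>p\<close> and \<open>f\<close> commute, for instance for powers of one element.
  Putting \<open>z\<close> between \<open>p\<close> and \<open>f\<close> removes this degeneracy.
\<close>

definition jordan_D ::
    "('x list \<Rightarrow>\<^sub>0 'k::field) \<Rightarrow> ('x list \<Rightarrow>\<^sub>0 'k) \<Rightarrow> ('x list \<Rightarrow>\<^sub>0 'k) \<Rightarrow> ('x list \<Rightarrow>\<^sub>0 'k)" where
  "jordan_D z p f = jordan_prod free_scale p (jordan_U z f) - jordan_prod free_scale f (jordan_U z p)"

lemma jordan_U_eq:
  fixes z f :: "'x list \<Rightarrow>\<^sub>0 'k::field"
  assumes "(2 :: 'k) \<noteq> 0"
  shows "jordan_U z f = z * f * z"
proof (rule poly_mapping_eqI)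
  fix w
  define c :: 'k where "c = 1 / 2"
  have "c + c = 1" using assms by (simp add: c_def field_simps)
  then have cc: "c * c + c * c + c * c + c * c = 1"
    by (metis distrib_left mult.right_neutral add.assoc)
  \<comment> \<open>Each of \<open>z z f\<close> and \<open>f z z\<close> occurs twice with either sign; only \<open>z f z\<close> survives, four times.\<close>
  have "coeff (jordan_U z f) w = c * c * coeff (z * f * z) w + c * c * coeff (z * f * z) w
      + c * c * coeff (z * f * z) w + c * c * coeff (z * f * z) w"
    unfolding jordan_U_def jordan_prod_def Let_def c_def[symmetric]
    by (simp add: lookup_add lookup_minus lookup_free_scale free.mult_scale_left
        free.mult_scale_right free.scale_right_distrib distrib_left distrib_right mult.assoc)
  also have "\<dots> = (c * c + c * c + c * c + c * c) * coeff (z * f * z) w"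
    by (simp only: distrib_right)
  finally show "coeff (jordan_U z f) w = coeff (z * f * z) w"
    by (simp only: cc mult_1)
qed

lemma jordan_D_eq:
  fixes z p f :: "'x list \<Rightarrow>\<^sub>0 'k::field"
  assumes "(2 :: 'k) \<noteq> 0"
  shows "jordan_D z p f
    = free_scale (1 / 2) ((p * z * f - f * z * p) * z - z * (p * z * f - f * z * p))"
  by (simp add: jordan_D_def jordan_U_eq[OF assms] jordan_prod_def algebra_simps)

lemma jordan_D_linear:
  fixes z p f g :: "'x list \<Rightarrow>\<^sub>0 'k::field"
  assumes "(2 :: 'k) \<noteq> 0"
  shows "jordan_D z p (free_scale a f + g) = free_scale a (jordan_D z p f) + jordan_D z p g"
  by (simp add: jordan_D_eq[OF assms] algebra_simps free.mult_scale_left free.mult_scale_right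
      mult.commute)

lemma jordan_D_self: "jordan_D z p p = 0"
  by (simp add: jordan_D_def)

lemma jordan_D_subalgebra:
  fixes S :: "('x list \<Rightarrow>\<^sub>0 'k::field) set"
  assumes "subalgebra free_scale (jordan_prod free_scale) S" "z \<in> S" "p \<in> S" "q \<in> S"
  shows "jordan_D z p q \<in> S"
  using assms
  by (simp add: subalgebra_def jordan_D_def jordan_U_def Let_def free.subspace_diff
      free.subspace_add)

lemma jordan_D_eq_0_imp_proportional:
  fixes p f :: "'x list \<Rightarrow>\<^sub>0 'k::field"
  assumes two: "(2 :: 'k) \<noteq> 0" and "p \<noteq> 0" "y1 \<noteq> y2"
    and D: "\<And>y. y \<in> {y1, y2} \<Longrightarrow> jordan_D (free_var y) p f = 0"
  shows "\<exists>c. f = free_scale c p"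
proof (rule proportional_if_brackets_commute[OF \<open>p \<noteq> 0\<close> \<open>y1 \<noteq> y2\<close>])
  fix y assume "y \<in> {y1, y2}"
  then show "(p * free_var y * f - f * free_var y * p) * free_var y
      = free_var y * (p * free_var y * f - f * free_var y * p)"
    using D[of y] two unfolding jordan_D_eq[OF two] by (simp add: free.scale_eq_0_iff)
qed

section \<open>Shortening linear combinations inside an ideal\<close>

text \<open>
  Linear combinations of exactly \<open>m\<close> elements of \<open>S\<close>, possibly with repetitions or with coefficients
  \<open>0\<close>. Linear maps that preserve \<open>S\<close> then preserve the number of terms, without any regrouping.
\<close>

primrec combinations :: "('x list \<Rightarrow>\<^sub>0 'k::field) set \<Rightarrow> nat \<Rightarrow> ('x list \<Rightarrow>\<^sub>0 'k) set" where
  "combinations S 0 = {0}"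
| "combinations S (Suc m) = {free_scale a p + g | a p g. p \<in> S \<and> g \<in> combinations S m}"

lemma in_span_imp_in_combinations:
  assumes "f \<in> free.span S"
  shows "\<exists>m. f \<in> combinations S m"
  using assms
proof (induction rule: free.span_induct_alt)
  case base
  then show ?case by (metis combinations.simps(1) singletonI)
next
  case (step c x y)
  then obtain m where "y \<in> combinations S m" by blast
  with step(1) have "free_scale c x + y \<in> combinations S (Suc m)" by auto
  then show ?case ..
qed

lemma jordan_D_combinations:
  fixes S :: "('x list \<Rightarrow>\<^sub>0 'k::field) set"
  assumes two: "(2 :: 'k) \<noteq> 0" and S: "\<And>q. q \<in> S \<Longrightarrow> jordan_D z p q \<in> S"
  shows "g \<in> combinations S m \<Longrightarrow> jordan_D z p g \<in> combinations S m"
proof (induction m arbitrary: g)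
  case 0
  then show ?case by (simp add: jordan_D_eq[OF two])
next
  case (Suc m)
  then obtain a q g' where "g = free_scale a q + g'" "q \<in> S" "g' \<in> combinations S m"
    by auto
  then show ?case
    using Suc.IH[of g'] S[of q] by (simp only: jordan_D_linear[OF two] combinations.simps) blast
qed

text \<open>
  Induction on the number of terms: \<open>jordan_D z p\<close> kills the term with \<open>p\<close>, so it maps \<open>f\<close> to a shorter
  combination in \<open>I\<close>. This is \<open>0\<close>, hence \<open>f\<close> is a multiple of \<open>p\<close>, and a nonzero multiple
  would put \<open>p\<close> into \<open>I\<close>.
\<close>

lemma ideal_element_eq_0:
  fixes S I :: "('x list \<Rightarrow>\<^sub>0 'k::field) set"
  assumes two: "(2 :: 'k) \<noteq> 0" and "y1 \<noteq> y2"
    and S: "\<And>y p q. y \<in> {y1, y2} \<Longrightarrow> p \<in> S \<Longrightarrow> q \<in> S \<Longrightarrow> jordan_D (free_var y) p q \<in> S"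
    and I: "\<And>y p q. y \<in> {y1, y2} \<Longrightarrow> p \<in> S \<Longrightarrow> q \<in> I \<Longrightarrow> jordan_D (free_var y) p q \<in> I"
    and I_scale: "\<And>a q. q \<in> I \<Longrightarrow> free_scale a q \<in> I"
    and S_I: "S \<inter> I \<subseteq> {0}"
  shows "f \<in> combinations S m \<Longrightarrow> f \<in> I \<Longrightarrow> f = 0"
proof (induction m arbitrary: f)
  case (Suc m)
  then obtain a p g where f: "f = free_scale a p + g" "p \<in> S" "g \<in> combinations S m"
    by auto
  show ?case
  proof (cases "p = 0")
    case True
    then show ?thesis using Suc f by simp
  next
    case False
    have "jordan_D (free_var y) p f = 0" if y: "y \<in> {y1, y2}" for y
    proof (rule Suc.IH)
      have "jordan_D (free_var y) p f = jordan_D (free_var y) p g"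
        by (simp add: f(1) jordan_D_linear[OF two] jordan_D_self)
      also have "\<dots> \<in> combinations S m"
        using S[OF y f(2)] f(3) by (rule jordan_D_combinations[OF two])
      finally show "jordan_D (free_var y) p f \<in> combinations S m" .
      show "jordan_D (free_var y) p f \<in> I"
        using I y f(2) Suc.prems(2) by blast
    qed
    then obtain c where c: "f = free_scale c p"
      using jordan_D_eq_0_imp_proportional[OF two False \<open>y1 \<noteq> y2\<close>] by blast
    show ?thesis
    proof (rule ccontr)
      assume "f \<noteq> 0"
      then have "c \<noteq> 0" using c by auto
      then have "p = free_scale (1 / c) f" by (simp add: c)
      then have "p \<in> I" using I_scale Suc.prems(2) by metis
      then show False using f(2) S_I False by blast
    qed
  qed
qed simp

section \<open>The canonical homomorphism into an algebra of the variety\<close>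

lemma update_conv_single_add:
  fixes p :: "'x list \<Rightarrow>\<^sub>0 'k::field"
  shows "w \<notin> support p \<Longrightarrow> Poly_Mapping.update w b p = Poly_Mapping.single w b + p"
  by (intro poly_mapping_eqI) (auto simp: lookup_update lookup_add lookup_single in_keys_iff)

lemma free_algebra_induct [case_names zero add]:
  fixes p :: "'x list \<Rightarrow>\<^sub>0 'k::field"
  assumes "P 0" and "\<And>w c q. P q \<Longrightarrow> P (Poly_Mapping.single w c + q)"
  shows "P p"
proof (induction p rule: update_induct)
  case (update p w b)
  then show ?case using assms(2) by (simp add: update_conv_single_add)
qed (use assms in simp)

lemma augmentation_induct [consumes 1, case_names zero add]:
  fixes p :: "'x list \<Rightarrow>\<^sub>0 'k::field"
  assumes "coeff p [] = 0"
    and "P 0" and "\<And>w c q. w \<noteq> [] \<Longrightarrow> P q \<Longrightarrow> P (Poly_Mapping.single w c + q)"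
  shows "P p"
  using assms(1)
proof (induction p rule: update_induct)
  case (update p w b)
  then have "w \<noteq> []" "coeff p [] = 0"
    by (auto simp: lookup_update in_keys_iff split: if_splits)
  then show ?case using update assms(3) by (simp add: update_conv_single_add)
qed (use assms in simp)

text \<open>
  The target ring may have no unit, so there is no natural value at the empty word; it is set to \<open>0\<close>.
  The evaluation is multiplicative only on elements without constant term, and all elements of the
  free special Jordan algebra are of this kind.
\<close>

primrec eval_word :: "('x \<Rightarrow> 'b::ring) \<Rightarrow> 'x list \<Rightarrow> 'b" where
  "eval_word j [] = 0"
| "eval_word j (x # w) = (if w = [] then j x else j x * eval_word j w)"

lemma eval_word_append:
  "u \<noteq> [] \<Longrightarrow> v \<noteq> [] \<Longrightarrow> eval_word j (u @ v) = eval_word j u * eval_word j v"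
  by (induction u) (auto simp: mult.assoc)

definition eval_free ::
    "('k::field \<Rightarrow> 'b::ring \<Rightarrow> 'b) \<Rightarrow> ('x \<Rightarrow> 'b) \<Rightarrow> ('x list \<Rightarrow>\<^sub>0 'k) \<Rightarrow> 'b" where
  "eval_free s j p = (\<Sum>w\<in>support p. s (coeff p w) (eval_word j w))"

context
  fixes s :: "'k::field \<Rightarrow> 'b::ring \<Rightarrow> 'b" and j :: "'x \<Rightarrow> 'b"
  assumes alg: "nonassoc_algebra s ((*) :: 'b \<Rightarrow> _)"
begin

interpretation B: nonassoc_algebra s "(*) :: 'b \<Rightarrow> _" by (rule alg)

lemma eval_free_0: "eval_free s j 0 = 0"
  by (simp add: eval_free_def)

lemma eval_free_add: "eval_free s j (p + q) = eval_free s j p + eval_free s j q"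
  unfolding eval_free_def
  by (rule setsum_keys_plus_distrib) (simp_all add: B.scale_left_distrib)

lemma eval_free_single: "eval_free s j (Poly_Mapping.single w c) = s c (eval_word j w)"
  by (simp add: eval_free_def)

lemma eval_free_scale: "eval_free s j (free_scale c p) = s c (eval_free s j p)"
proof (induction p rule: free_algebra_induct)
  case (add w d q)
  have "free_scale c (Poly_Mapping.single w d) = Poly_Mapping.single w (c * d)"
    by (simp add: free_scale_conv_mult mult_single)
  then show ?case
    using add by (simp add: free.scale_right_distrib eval_free_add eval_free_single
        B.scale_right_distrib)
qed (simp add: eval_free_0)

lemma eval_free_mult:
  assumes "coeff p [] = 0" "coeff q [] = 0"
  shows "eval_free s j (p * q) = eval_free s j p * eval_free s j q"
proof -
  have single: "eval_free s j (Poly_Mapping.single u c * q)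
      = eval_free s j (Poly_Mapping.single u c) * eval_free s j q" if "u \<noteq> []" for u c
    using assms(2)
  proof (induction q rule: augmentation_induct)
    case (add v d q)
    then show ?case
      using that
      by (simp add: distrib_left eval_free_add mult_single eval_free_single plus_list_def
          eval_word_append B.mult_scale_left B.mult_scale_right)
  qed (simp add: eval_free_0)
  show ?thesis
    using assms(1)
    by (induction p rule: augmentation_induct)
      (simp_all add: eval_free_0 distrib_right eval_free_add single)
qed

lemma eval_free_var: "eval_free s j (free_var x) = j x"
  by (simp add: free_var_def eval_free_single)

end

lemma free_SJ_subalgebra:
  "subalgebra free_scale (jordan_prod free_scale) (free_SJ Y :: ('x list \<Rightarrow>\<^sub>0 'k::field) set)"
  unfolding free_SJ_def
  by (rule hull_in) (auto simp: subalgebra_def intro!: free.subspace_Inter)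

lemma free_var_in_free_SJ: "y \<in> Y \<Longrightarrow> free_var y \<in> free_SJ Y"
  unfolding free_SJ_def by (simp add: hull_inc)

text \<open>
  If the algebra is the image of a special Jordan algebra \<open>J\<close> inside an associative algebra, preimages
  in \<open>J\<close> of the prescribed values define an evaluation of the free associative algebra. It maps the
  free special Jordan algebra into \<open>J\<close>, where the given homomorphism can be applied.
\<close>

lemma canonical_hom_exists:
  fixes scale :: "'k::field \<Rightarrow> 'a::ab_group_add \<Rightarrow> 'a" and g :: "'x \<Rightarrow> 'a"
  assumes "in_SJ TYPE('b::ring) scale mult"
  shows "\<exists>h. algebra_hom_on (free_SJ Y) free_scale (jordan_prod free_scale) scale mult h \<and>
    (\<forall>y\<in>Y. h (free_var y) = g y)"
proof -
  obtain s :: "'k \<Rightarrow> 'b \<Rightarrow> 'b" and J h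
    where B: "nonassoc_algebra s ((*) :: 'b \<Rightarrow> _)"
      and J: "subalgebra s (jordan_prod s) J"
      and h: "algebra_hom_on J s (jordan_prod s) scale mult h" and surj: "h ` J = UNIV"
    using assms unfolding in_SJ_def special_jordan_def by blast
  interpret B: nonassoc_algebra s "(*) :: 'b \<Rightarrow> _" by (rule B)
  define j where "j x = inv_into J h (g x)" for x
  have j: "j x \<in> J" "h (j x) = g x" for x
    using surj by (auto simp: j_def intro: inv_into_into f_inv_into_f)
  \<comment> \<open>Closure of \<open>E\<close> under the operations shows both facts about the free special Jordan algebra at once:
    no constant terms, and values in \<open>J\<close>.\<close>
  define E where "E = {p. coeff p [] = 0 \<and> eval_free s j p \<in> J}"
  have coeff_mult: "coeff (p * q) [] = 0" if "coeff p [] = 0" "coeff q [] = 0"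
    for p q :: "'x list \<Rightarrow>\<^sub>0 'k"
  proof -
    have "[] \<notin> support (p * q)"
      using keys_mult[of p q] that by (auto simp: plus_list_def in_keys_iff)
    then show ?thesis by (simp add: in_keys_iff)
  qed
  have eval_jordan: "eval_free s j (jordan_prod free_scale p q)
      = jordan_prod s (eval_free s j p) (eval_free s j q)"
    if "coeff p [] = 0" "coeff q [] = 0" for p q :: "'x list \<Rightarrow>\<^sub>0 'k"
    using that
    by (simp add: jordan_prod_def eval_free_scale[OF B] eval_free_add[OF B] eval_free_mult[OF B])
  have "subalgebra free_scale (jordan_prod free_scale) E"
    unfolding subalgebra_def free.subspace_def
  proof (intro conjI allI ballI)
    show "0 \<in> E"
      using J by (simp add: E_def eval_free_0[OF B] subalgebra_def B.subspace_def)
    show "p + q \<in> E" if "p \<in> E" "q \<in> E" for p q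
      using that J
      by (simp add: E_def eval_free_add[OF B] lookup_add subalgebra_def B.subspace_def)
    show "free_scale c p \<in> E" if "p \<in> E" for c p
      using that J
      by (simp add: E_def eval_free_scale[OF B] lookup_free_scale subalgebra_def B.subspace_def)
    show "jordan_prod free_scale p q \<in> E" if "p \<in> E" "q \<in> E" for p q
    proof -
      have "coeff (jordan_prod free_scale p q) [] = 0"
        using that by (simp add: E_def jordan_prod_def lookup_free_scale lookup_add coeff_mult)
      then show ?thesis
        using that J by (simp add: E_def eval_jordan subalgebra_def)
    qed
  qed
  moreover have "free_var ` Y \<subseteq> E"
    using j by (auto simp: E_def eval_free_var[OF B] free_var_def[of x for x] lookup_single
        eval_free_single[OF B])
  ultimately have E: "free_SJ Y \<subseteq> E"
    unfolding free_SJ_def by (intro hull_minimal)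
  have "algebra_hom_on (free_SJ Y) free_scale (jordan_prod free_scale) scale mult
      (\<lambda>p. h (eval_free s j p))"
    unfolding algebra_hom_on_def
  proof (intro conjI allI ballI)
    fix p q :: "'x list \<Rightarrow>\<^sub>0 'k" and c
    assume p: "p \<in> free_SJ Y"
    then have pE: "p \<in> E" using E by blast
    then show "h (eval_free s j (free_scale c p)) = scale c (h (eval_free s j p))"
      using h by (simp add: E_def eval_free_scale[OF B] algebra_hom_on_def)
    assume "q \<in> free_SJ Y"
    then have qE: "q \<in> E" using E by blast
    show "h (eval_free s j (p + q)) = h (eval_free s j p) + h (eval_free s j q)"
      using h pE qE by (simp add: E_def eval_free_add[OF B] algebra_hom_on_def)
    show "h (eval_free s j (jordan_prod free_scale p q))
        = mult (h (eval_free s j p)) (h (eval_free s j q))"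
      using h pE qE by (simp add: E_def eval_jordan algebra_hom_on_def)
  qed
  then show ?thesis
    by (intro exI[of _ "\<lambda>p. h (eval_free s j p)"]) (simp add: eval_free_var[OF B] j)
qed

section \<open>Extension of scalars\<close>

lemma (in nonassoc_algebra) span_mult_closed:
  assumes S: "\<And>x y. x \<in> S \<Longrightarrow> y \<in> S \<Longrightarrow> mult x y \<in> S"
    and x: "x \<in> span S" and y: "y \<in> span S"
  shows "mult x y \<in> span S"
proof -
  have zero: "mult 0 y = 0" "mult y 0 = 0" for y
    using mult_add_left[of 0 0 y] mult_add_right[of y 0 0] by simp_all
  have generator: "mult x y \<in> span S" if "x \<in> S" for x
    using y
    by (induction rule: span_induct_alt)
      (simp_all add: zero span_zero mult_add_right mult_scale_right span_add span_scale
        span_base S that)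
  show ?thesis
    using x
    by (induction rule: span_induct_alt)
      (simp_all add: generator zero span_zero mult_add_left mult_scale_left span_add span_scale)
qed

context field_extension
begin

lemma emb_0: "\<iota> 0 = 0"
  using emb_add[of 0 0] by (simp only: add_0_left add_cancel_right_right)

lemma emb_eq_0_iff: "\<iota> x = 0 \<longleftrightarrow> x = 0"
proof
  assume "\<iota> x = 0"
  then have "\<iota> (x * (1 / x)) = 0" by (simp only: emb_mult mult_zero_left)
  then show "x = 0" using emb_one by (cases "x = 0") simp_all
qed (simp add: emb_0)

lemma emb_2: "\<iota> 2 = 2"
  using emb_add[of 1 1] by (simp add: emb_one)

lemma emb_half: "(2 :: 'k) \<noteq> 0 \<Longrightarrow> \<iota> (1 / 2) = 1 / 2"
  using emb_mult[of 2 "1 / 2"] emb_eq_0_iff[of 2] by (simp add: emb_one emb_2 field_simps)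

abbreviation extend_scalars :: "('x list \<Rightarrow>\<^sub>0 'k) \<Rightarrow> ('x list \<Rightarrow>\<^sub>0 'f)" where
  "extend_scalars \<equiv> Poly_Mapping.map \<iota>"

lemma coeff_extend_scalars: "coeff (extend_scalars p) w = \<iota> (coeff p w)"
  using emb_0 by (simp add: Poly_Mapping.map.rep_eq when_def)

lemma extend_scalars_0: "extend_scalars 0 = 0"
  by (intro poly_mapping_eqI) (simp add: coeff_extend_scalars emb_0)

lemma extend_scalars_add: "extend_scalars (p + q) = extend_scalars p + extend_scalars q"
  by (intro poly_mapping_eqI) (simp add: coeff_extend_scalars lookup_add emb_add)

lemma extend_scalars_scale: "extend_scalars (free_scale c p) = free_scale (\<iota> c) (extend_scalars p)"
  by (intro poly_mapping_eqI) (simp add: coeff_extend_scalars lookup_free_scale emb_mult)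

lemma extend_scalars_single: "extend_scalars (Poly_Mapping.single w c) = Poly_Mapping.single w (\<iota> c)"
  by (intro poly_mapping_eqI) (simp add: coeff_extend_scalars lookup_single emb_0 when_def)

lemma extend_scalars_free_var: "extend_scalars (free_var x) = free_var x"
  by (simp add: free_var_def extend_scalars_single emb_one)

lemma extend_scalars_mult: "extend_scalars (p * q) = extend_scalars p * extend_scalars q"
proof (induction p rule: free_algebra_induct)
  case (add u c p)
  have "extend_scalars (Poly_Mapping.single u c * q)
      = extend_scalars (Poly_Mapping.single u c) * extend_scalars q"
    by (induction q rule: free_algebra_induct)
      (simp_all add: extend_scalars_0 distrib_left extend_scalars_add mult_single
        extend_scalars_single emb_mult)
  then show ?case
    using add by (simp add: distrib_right extend_scalars_add)
qed (simp add: extend_scalars_0)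

lemma extend_scalars_jordan_prod:
  assumes "(2 :: 'k) \<noteq> 0"
  shows "extend_scalars (jordan_prod free_scale p q)
    = jordan_prod free_scale (extend_scalars p) (extend_scalars q)"
  by (simp add: jordan_prod_def extend_scalars_scale extend_scalars_add extend_scalars_mult
      emb_half[OF assms])

lemma extend_scalars_diff: "extend_scalars (p - q) = extend_scalars p - extend_scalars q"
  using extend_scalars_add[of "p - q" q] by simp

lemma extend_scalars_jordan_D:
  assumes "(2 :: 'k) \<noteq> 0"
  shows "extend_scalars (jordan_D z p q)
    = jordan_D (extend_scalars z) (extend_scalars p) (extend_scalars q)"
  by (simp add: jordan_D_def jordan_U_def Let_def extend_scalars_diff extend_scalars_add
      extend_scalars_jordan_prod[OF assms])

lemma extend_scalars_free_SJ:
  assumes two: "(2 :: 'k) \<noteq> 0" and "p \<in> free_SJ Y"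
  shows "extend_scalars p \<in> free_SJ Y"
proof -
  define E :: "('a list \<Rightarrow>\<^sub>0 'k) set" where "E = {p. extend_scalars p \<in> free_SJ Y}"
  have "subalgebra free_scale (jordan_prod free_scale) E"
    using free_SJ_subalgebra[of Y, where 'k = 'f]
    by (auto simp: E_def subalgebra_def free.subspace_def extend_scalars_0 extend_scalars_add
        extend_scalars_scale extend_scalars_jordan_prod[OF two])
  moreover have "free_var ` Y \<subseteq> E"
    by (auto simp: E_def extend_scalars_free_var free_var_in_free_SJ)
  ultimately have "free_SJ Y \<subseteq> E"
    unfolding free_SJ_def by (intro hull_minimal)
  then show ?thesis using assms(2) by (auto simp: E_def)
qed

text \<open>
  The Jordan product is bilinear, so the span of a set that is closed under it is a subalgebra. Hence the free algebra over the large field consists of linear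
  combinations of elements defined over the small field.
\<close>

lemma free_SJ_subset_span:
  assumes two: "(2 :: 'k) \<noteq> 0"
  shows "(free_SJ Y :: ('x list \<Rightarrow>\<^sub>0 'f) set) \<subseteq> free.span (extend_scalars ` free_SJ Y)"
  unfolding free_SJ_def[where 'k = 'f]
proof (rule hull_minimal)
  show "free_var ` Y \<subseteq> free.span (extend_scalars ` free_SJ Y)"
    by (metis (no_types, lifting) extend_scalars_free_var free.span_base free_var_in_free_SJ
        image_eqI image_subsetI)
  have "jordan_prod free_scale p q \<in> extend_scalars ` free_SJ Y"
    if "p \<in> extend_scalars ` free_SJ Y" "q \<in> extend_scalars ` free_SJ Y"
    for p q :: "'x list \<Rightarrow>\<^sub>0 'f"
    using that free_SJ_subalgebra[of Y, where 'k = 'k]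
    by (auto simp: subalgebra_def extend_scalars_jordan_prod[OF two, symmetric])
  then show "subalgebra free_scale (jordan_prod free_scale)
      (free.span (extend_scalars ` free_SJ Y) :: ('x list \<Rightarrow>\<^sub>0 'f) set)"
    by (auto simp: subalgebra_def free.subspace_span intro!: free_jordan.span_mult_closed)
qed

end

lemma two_neq_0_if_CHAR_neq_2:
  assumes "CHAR('k::field) \<noteq> 2"
  shows "(2 :: 'k) \<noteq> 0"
proof
  assume "(2 :: 'k) = 0"
  then have "of_nat 2 = (0 :: 'k)" by simp
  then have "CHAR('k) dvd 2" by (simp only: of_nat_eq_0_iff_char_dvd)
  then have "CHAR('k) \<le> 2" "CHAR('k) \<noteq> 0"
    by (auto intro: dvd_imp_le intro!: gr0I)
  then show False using assms CHAR_not_1[where 'a='k] by linarith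
qed

theorem theorem2p6:
  fixes \<iota> :: "'k::field \<Rightarrow> 'f::field"
    and scale :: "'f \<Rightarrow> 'a::ab_group_add \<Rightarrow> 'a"
    and mult :: "'a \<Rightarrow> 'a \<Rightarrow> 'a"
    and Y :: "'a set"
  assumes "CHAR('k) \<noteq> 2"
    and "field_extension \<iota>"
    and "in_SJ TYPE('b::ring) scale mult"
    and "finite Y" and "card Y \<ge> 2"
    and "generates_free_SJ (\<lambda>c. scale (\<iota> c)) mult Y"
  shows "generates_free_SJ scale mult Y"
proof -
  interpret field_extension \<iota> by fact
  have two: "(2 :: 'k) \<noteq> 0" using two_neq_0_if_CHAR_neq_2 assms(1) by blast
  then have twoF: "(2 :: 'f) \<noteq> 0" using emb_2 emb_eq_0_iff by metis
  interpret A: nonassoc_algebra scale mult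
    using assms(3) by (simp add: in_SJ_def)
  have mult_0: "mult 0 y = 0" "mult y 0 = 0" for y
    using A.mult_add_left[of 0 0 y] A.mult_add_right[of y 0 0] by simp_all
  note SJK = free_SJ_subalgebra[of Y, where 'k = 'k]
  note SJF = free_SJ_subalgebra[of Y, where 'k = 'f]
  obtain hK where hK: "algebra_hom_on (free_SJ Y) free_scale (jordan_prod free_scale)
        (\<lambda>c. scale (\<iota> c)) mult hK"
      and hK_var: "\<forall>y\<in>Y. hK (free_var y) = y" and inj: "inj_on hK (free_SJ Y)"
    using assms(6) unfolding generates_free_SJ_def by blast
  obtain h where h: "algebra_hom_on (free_SJ Y) free_scale (jordan_prod free_scale) scale mult h"
      and h_var: "\<forall>y\<in>Y. h (free_var y) = y"
    using canonical_hom_exists[OF assms(3), of Y "\<lambda>y. y"] by blast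
  \<comment> \<open>The canonical homomorphism over \<open>F\<close>, composed with extension of scalars, is the one over \<open>K\<close>.\<close>
  have "algebra_hom_on (free_SJ Y) free_scale (jordan_prod free_scale)
      (\<lambda>c. scale (\<iota> c)) mult (\<lambda>p. h (extend_scalars p))"
    using h
    by (simp add: algebra_hom_on_def extend_scalars_add extend_scalars_scale
        extend_scalars_jordan_prod[OF two] extend_scalars_free_SJ[OF two])
  then have h_extend: "h (extend_scalars p) = hK p" if "p \<in> free_SJ Y" for p
    using canonical_hom_unique[OF _ hK _ that] that h_var hK_var
    by (simp add: extend_scalars_free_var)
  have hK_0: "hK 0 = 0"
    using hK SJK unfolding algebra_hom_on_def subalgebra_def
    by (metis add_cancel_right_right free.subspace_0)
  have diff: "p - q \<in> free_SJ Y" if "p \<in> free_SJ Y" "q \<in> free_SJ Y"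
    for p q :: "'a list \<Rightarrow>\<^sub>0 'f"
    using that SJF by (simp add: subalgebra_def free.subspace_diff)
  have h_diff: "h (p - q) = h p - h q" if "p \<in> free_SJ Y" "q \<in> free_SJ Y" for p q
  proof -
    have "h (p - q + q) = h (p - q) + h q"
      using h that diff[OF that] by (simp only: algebra_hom_on_def)
    then show ?thesis by simp
  qed
  define S where "S = extend_scalars ` (free_SJ Y :: ('a list \<Rightarrow>\<^sub>0 'k) set)"
  define I where "I = {p \<in> free_SJ Y. h p = 0}"
  have S_sub: "S \<subseteq> free_SJ Y"
    by (auto simp: S_def extend_scalars_free_SJ[OF two])
  obtain y1 y2 where y: "y1 \<in> Y" "y2 \<in> Y" "y1 \<noteq> y2"
    using assms(4,5) by (metis card_le_Suc0_iff_eq not_less_eq_eq numeral_2_eq_2)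
  have kernel: "f = 0" if f: "f \<in> free_SJ Y" "h f = 0" for f
  proof -
    obtain m where "f \<in> combinations S m"
      using in_span_imp_in_combinations f(1) free_SJ_subset_span[OF two, of Y]
      unfolding S_def by blast
    then show ?thesis
    proof (rule ideal_element_eq_0[OF twoF y(3), of S I, rotated 4])
      show "f \<in> I" using f by (simp add: I_def)
      show "free_scale a q \<in> I" if "q \<in> I" for a q
        using that h SJF by (simp add: I_def algebra_hom_on_def subalgebra_def free.subspace_def)
      show "S \<inter> I \<subseteq> {0}"
      proof
        fix q assume "q \<in> S \<inter> I"
        then obtain p where p: "p \<in> free_SJ Y" "q = extend_scalars p" "h q = 0"
          by (auto simp: S_def I_def)
        then have "hK p = hK 0" using h_extend hK_0 by simp
        then have "p = 0"
          using inj p(1) SJK by (simp add: inj_on_eq_iff subalgebra_def free.subspace_0)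
        then show "q \<in> {0}" using p by (simp add: extend_scalars_0)
      qed
    next
      fix y p q assume y': "y \<in> {y1, y2}" and p: "p \<in> S"
      then have z: "free_var y \<in> (free_SJ Y :: ('a list \<Rightarrow>\<^sub>0 'f) set)"
        using y by (auto intro: free_var_in_free_SJ)
      have zK: "free_var y \<in> (free_SJ Y :: ('a list \<Rightarrow>\<^sub>0 'k) set)"
        using y y' by (auto intro: free_var_in_free_SJ)
      show "jordan_D (free_var y) p q \<in> S" if q: "q \<in> S"
      proof -
        obtain p' q' where "p' \<in> free_SJ Y" "p = extend_scalars p'"
            "q' \<in> free_SJ Y" "q = extend_scalars q'"
          using p q unfolding S_def by blast
        then show ?thesis
          using jordan_D_subalgebra[OF SJK zK, of p' q']
          by (auto simp: S_def extend_scalars_jordan_D[OF two] extend_scalars_free_var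
              intro!: image_eqI[of _ _ "jordan_D (free_var y) p' q'"])
      qed
      show "jordan_D (free_var y) p q \<in> I" if "q \<in> I"
      proof -
        have pq: "p \<in> free_SJ Y" "q \<in> free_SJ Y" "h q = 0"
          using p S_sub that by (auto simp: I_def)
        have prod: "jordan_prod free_scale r s \<in> free_SJ Y"
            "h (jordan_prod free_scale r s) = mult (h r) (h s)"
          if "r \<in> free_SJ Y" "s \<in> free_SJ Y" for r s
          using h that SJF by (simp_all add: algebra_hom_on_def subalgebra_def)
        have add: "r + s \<in> free_SJ Y" "h (r + s) = h r + h s"
          if "r \<in> free_SJ Y" "s \<in> free_SJ Y" for r s
          using h that SJF by (simp_all add: algebra_hom_on_def subalgebra_def free.subspace_add)
        show ?thesis
          using pq z
          by (simp add: I_def jordan_D_def jordan_U_def Let_def prod add diff h_diff mult_0)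
      qed
    qed
  qed
  have "inj_on h (free_SJ Y)"
  proof (rule inj_onI)
    fix p q assume "p \<in> free_SJ Y" "q \<in> free_SJ Y" "h p = h q"
    then have "p - q = 0"
      by (intro kernel) (simp_all add: h_diff diff)
    then show "p = q" by simp
  qed
  then show ?thesis
    unfolding generates_free_SJ_def using h h_var by blast
qed

end
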